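(* Let $\beta\in(0,1)$, $\delta>1/2$ and $c_1,c_k\in(0,1)$ be constants not depending on $p$ (here $c_k$ is just the name of a constant, although the number of steps $k$ depends on $p$). For each dimension $p$ let $$k=k(p)=\max\{\lceil \log_2\log p\rceil,0\}+2,$$ and let $R_1,\dots,R_k>0$ (which may depend on $p$) satisfy $\sum_{j=1}^k R_j\le p$, $R_{j+1}/R_j\ge\delta$ for $j=1,\dots,k-2$, $R_1=c_1p$ and $R_k=c_kp$. Let $x=x(p)\in\mathbb{R}^p$, $x\ge 0$, be a deterministic vector with $p^{1-\beta}$ non-zero components, each equal to $\mu(p)>0$, at arbitrary locations; in part (ii) the case $x=0$ is also considered. Run the Distilled Sensing procedure on $x$ with $k$ steps and resource allocation $R_1,\dots,R_k$, obtaining the output index set $I_k$ and observations $\{y_{i,k}: i\in I_k\}$, and define $$\widehat{\mathcal S}_{\rm DS}:=\{i\in I_k:\ y_{i,k}>\sqrt{2/c_k}\}.$$ Then: (i) If $\mu(p)\to\infty$ as $p\to\infty$, then for $x$ with $p^{1-\beta}$ non-zero components of amplitude $\mu(p)$, as $p\to\infty$, $$\mathrm{FDP}(\widehat{\mathcal S}_{\rm DS})\to 0\quad\text{and}\quad \mathrm{NDP}(\widehat{\mathcal S}_{\rm DS})\to 0\quad\text{in probability}.$$ (ii) If $\mu(p)>\max\{\sqrt{4/c_1},\,2\sqrt{2/c_k}\}$ (a constant), then $$\lim_{p\to\infty}\Pr(\widehat{\mathcal S}_{\rm DS}=\emptyset)=\begin{cases}1,&\text{if } x=0,\\ 0,&\text{if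 } x\ne 0,\end{cases}$$ where $x\neq 0$ means that $x$ has $p^{1-\beta}$ non-zero components of amplitude $\mu(p)$.
   Context: $\log$ is the natural logarithm and $\log_2$ the base-2 logarithm. Distilled Sensing (DS). Input: a vector $x\in\mathbb{R}^p$ (unknown to the procedure), a number of steps $k$, and a resource allocation $R_1,\dots,R_k>0$ with $\sum_{j=1}^kR_j\le p$. Let $w_{i,j}$, $1\le i\le p$, $1\le j\le k$, be i.i.d. $\mathcal N(0,1)$. Set $I_1=\{1,\dots,p\}$. For $j=1,\dots,k$: set the precision $\gamma_{i,j}=R_j/|I_j|$ for $i\in I_j$ and $\gamma_{i,j}=0$ for $i\notin I_j$ (meaning component $i$ is not observed at step $j$); observe $y_{i,j}=x_i+\gamma_{i,j}^{-1/2}w_{i,j}$ for $i\in I_j$; set $I_{j+1}=\{i\in I_j:\ y_{i,j}>0\}$. Output: the final index set $I_k$ and the observations $\{y_{i,k}: i\in I_k\}$. Let $\mathcal S=\{i: x_i\ne0\}$ be the signal support. For an estimator $\widehat{\mathcal S}$ of $\mathcal S$, the false-discovery proportion and the non-discovery proportion are $$\mathrm{FDP}(\widehat{\mathcal S})=\frac{|\widehat{\mathcal S}\setminus\mathcal S|}{|\widehat{\mathcal S}|},\qquad \mathrm{NDP}(\widehat{\mathcal S})=\frac{|\mathcal S\setminus\widehat{\mathcal S}|}{|\mathcal S|}.$$ The quantity $p^{1-\beta}$ is treated as an integer. *)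

theory Defs
  imports "HOL-Probability.Probability"
begin

text \<open>
  A vector in \<open>p\<close>-dimensional space is a function on \<open>nat\<close> of which only the values on
  \<open>{1..p}\<close> are used.  Likewise \<open>R j\<close> is used for \<open>1 \<le> j \<le> k\<close> and the noise \<open>w i j\<close> for
  \<open>1 \<le> i \<le> p\<close>, \<open>1 \<le> j \<le> k\<close>; \<open>w\<close> is one realisation of the noise.
\<close>

definition support :: "nat \<Rightarrow> (nat \<Rightarrow> real) \<Rightarrow> nat set" where
  "support p x = {i \<in> {1..p}. x i \<noteq> 0}"

text \<open>
  The number \<open>p powr (1 - \<beta>)\<close> need not be an integer; both roundings are admitted.
\<close>

definition sparse_signal :: "nat \<Rightarrow> real \<Rightarrow> real \<Rightarrow> (nat \<Rightarrow> real) \<Rightarrow> bool" where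
  "sparse_signal p \<beta> m x \<longleftrightarrow>
     (card (support p x) = nat \<lfloor>real p powr (1 - \<beta>)\<rfloor> \<or>
      card (support p x) = nat \<lceil>real p powr (1 - \<beta>)\<rceil>) \<and>
     (\<forall>i \<in> support p x. x i = m)"

text \<open>
  At \<open>p = 1\<close> the library value \<open>log 2 0 = 0\<close> gives the same result as reading \<open>log 2 0\<close> as
  minus infinity.
\<close>

definition ds_steps :: "nat \<Rightarrow> nat" where
  "ds_steps p = nat (max \<lceil>log 2 (ln (real p))\<rceil> 0) + 2"

definition ds_precision :: "(nat \<Rightarrow> real) \<Rightarrow> nat set \<Rightarrow> nat \<Rightarrow> nat \<Rightarrow> real" where
  "ds_precision R I i j = (if i \<in> I then R j / real (card I) else 0)"

text \<open>Meaningful for \<open>i \<in> I\<close> only, where \<open>I\<close> is the index set of step \<open>j\<close>.\<close>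

definition ds_measure ::
  "(nat \<Rightarrow> real) \<Rightarrow> (nat \<Rightarrow> real) \<Rightarrow> (nat \<Rightarrow> nat \<Rightarrow> real) \<Rightarrow> nat set \<Rightarrow> nat \<Rightarrow> nat \<Rightarrow> real" where
  "ds_measure x R w I i j = x i + ds_precision R I i j powr (- 1 / 2) * w i j"

text \<open>Steps are numbered from 1; index 0 is a dummy.\<close>

fun ds_index ::
  "nat \<Rightarrow> (nat \<Rightarrow> real) \<Rightarrow> (nat \<Rightarrow> real) \<Rightarrow> (nat \<Rightarrow> nat \<Rightarrow> real) \<Rightarrow> nat \<Rightarrow> nat set" where
  "ds_index p x R w 0 = {1..p}"
| "ds_index p x R w (Suc 0) = {1..p}"
| "ds_index p x R w (Suc (Suc j)) =
     {i \<in> ds_index p x R w (Suc j). ds_measure x R w (ds_index p x R w (Suc j)) i (Suc j) > 0}"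

definition ds_obs ::
  "nat \<Rightarrow> (nat \<Rightarrow> real) \<Rightarrow> (nat \<Rightarrow> real) \<Rightarrow> (nat \<Rightarrow> nat \<Rightarrow> real) \<Rightarrow> nat \<Rightarrow> nat \<Rightarrow> real" where
  "ds_obs p x R w i j = ds_measure x R w (ds_index p x R w j) i j"

definition S_DS ::
  "nat \<Rightarrow> real \<Rightarrow> (nat \<Rightarrow> real) \<Rightarrow> (nat \<Rightarrow> real) \<Rightarrow> (nat \<Rightarrow> nat \<Rightarrow> real) \<Rightarrow> nat set" where
  "S_DS p c x R w =
     {i \<in> ds_index p x R w (ds_steps p). ds_obs p x R w i (ds_steps p) > sqrt (2 / c)}"

definition FDP :: "nat set \<Rightarrow> nat set \<Rightarrow> real" where
  "FDP S T = real (card (T - S)) / real (card T)"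

definition NDP :: "nat set \<Rightarrow> nat set \<Rightarrow> real" where
  "NDP S T = real (card (S - T)) / real (card S)"

definition iid_std_normal :: "'a measure \<Rightarrow> (nat \<times> nat) set \<Rightarrow> (nat \<Rightarrow> nat \<Rightarrow> 'a \<Rightarrow> real) \<Rightarrow> bool" where
  "iid_std_normal M A W \<longleftrightarrow>
     prob_space.indep_vars M (\<lambda>_. borel) (\<lambda>(i, j). W i j) A \<and>
     (\<forall>(i, j) \<in> A. distributed M lborel (W i j) std_normal_density)"

text \<open>The random variable \<open>X n\<close> may live on a different probability space for each \<open>n\<close>.\<close>

definition tendsto_in_prob :: "(nat \<Rightarrow> 'a measure) \<Rightarrow> (nat \<Rightarrow> 'a \<Rightarrow> real) \<Rightarrow> real \<Rightarrow> bool" where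
  "tendsto_in_prob M X c \<longleftrightarrow>
     (\<forall>\<epsilon>>0. (\<lambda>n. measure (M n) {\<omega> \<in> space (M n). \<bar>X n \<omega> - c\<bar> > \<epsilon>}) \<longlonglongrightarrow> 0)"

end

theory Submission
  imports Defs "HOL-Real_Asymp.Real_Asymp"
begin

text \<open>
  A null component passes a distillation step exactly when its noise is positive.  The sets of
  surviving null components are therefore independent of the signal and of the allocation, and each
  step roughly halves them.  Chebyshev's inequality, summed over the steps, shows that with
  probability tending to 1 all index sets satisfy \<open>card I\<^sub>j \<le> 3/2 * p / 2 ^ (j - 1)\<close>; the support, of
  size about \<open>p powr (1 - \<beta>)\<close>, is negligible because \<open>2 ^ ds_steps p \<le> 8 * ln p\<close>.

  Two consequences follow from this crowd bound.  First, \<open>2 * ln p \<le> 2 ^ (ds_steps p - 1)\<close>, so a null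
  component can exceed the final cut-off only if its last noise variable exceeds
  \<open>sqrt (8/3 * ln p)\<close>.  By the Gaussian tail bound and a union bound over \<open>p\<close> components this has
  probability at most \<open>p powr (-1/3)\<close>: asymptotically there are no false discoveries at all.
  Second, the allocation shrinks per step at most by the factor \<open>\<rho> = min \<delta> 1 > 1/2\<close>, while the crowd
  halves, so the precision at step \<open>j\<close> is at least of order \<open>(2 * \<rho>) ^ (j - 1)\<close>.  A signal component
  is then found as soon as its own noise stays above deterministic, geometrically decreasing
  thresholds (\<open>good_event\<close>).  This decouples the components, which otherwise interact through the
  sizes of the index sets.

  The number of signal components with favourable noise is thus binomial, and its success
  probability \<open>persistence\<close> is a product of Gaussian tails.  It is \<open>1 - O(1 / \<mu>\<^sup>2)\<close>
  (\<open>persistence_ge\<close>), which gives part (i) for \<open>\<mu> \<longlonglongrightarrow> \<infinity>\<close>; and it is bounded away from 0 for an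
  amplitude bounded away from 0, uniformly in the number of steps (\<open>persistence_bounded_below\<close>).
  As the support grows, some signal component is then found with probability tending to 1, which
  gives part (ii).
\<close>

section \<open>Tails of the standard normal distribution\<close>
abbreviation std_normal :: "real measure" where
  "std_normal \<equiv> density lborel std_normal_density"

definition gauss_tail :: "real \<Rightarrow> real" where
  "gauss_tail t = measure std_normal {t<..}"

interpretation std_normal: prob_space std_normal
  by (rule prob_space_normal_density) simp

lemma std_normal_singleton: "measure std_normal {t} = 0"
proof -
  have "emeasure std_normal {t} = 0"
    by (auto simp: emeasure_density intro!: nn_integral_null_set)
  then show ?thesis by (simp add: measure_def)
qed

lemma std_normal_reflect:
  assumes "A \<in> sets borel"
  shows "measure std_normal (uminus -` A) = measure std_normal A"
proof -
  have "distributed std_normal lborel (\<lambda>x. x) (normal_density 0 1)"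
    by (auto simp: distributed_def intro!: distr_id2)
  then have "distributed std_normal lborel (\<lambda>x. 0 + (-1) * x) (normal_density (0 + (-1) * 0) (\<bar>-1\<bar> * 1))"
    by (intro std_normal.normal_density_affine) auto
  then have "distr std_normal lborel uminus = std_normal"
    by (simp add: distributed_def)
  then have "measure std_normal A = measure (distr std_normal lborel uminus) A" by simp
  also have "\<dots> = measure std_normal (uminus -` A)"
    using assms by (subst measure_distr) auto
  finally show ?thesis by simp
qed

text \<open>
  For \<open>x \<ge> t \<ge> 0\<close> the standard density is at most \<open>exp (- t\<^sup>2 / 2)\<close> times the density of the normal
  distribution centred at \<open>t\<close>, which integrates to one.
\<close>
lemma std_normal_chernoff:
  assumes "t \<ge> 0"
  shows "measure std_normal {t..} \<le> exp (- t\<^sup>2 / 2)"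
proof -
  have "emeasure std_normal {t..} = (\<integral>\<^sup>+x. ennreal (std_normal_density x) * indicator {t..} x \<partial>lborel)"
    by (simp add: emeasure_density)
  also have "\<dots> \<le> (\<integral>\<^sup>+x. ennreal (exp (- t\<^sup>2 / 2)) * ennreal (normal_density t 1 x) \<partial>lborel)"
  proof (rule nn_integral_mono)
    fix x
    have "std_normal_density x \<le> exp (- t\<^sup>2 / 2) * normal_density t 1 x" if "x \<ge> t"
    proof -
      have "t * t \<le> t * x" using that assms by (intro mult_left_mono) auto
      then have "- x\<^sup>2 / 2 \<le> - t\<^sup>2 / 2 + - (x - t)\<^sup>2 / 2"
        by (simp add: power2_eq_square field_simps)
      then have "exp (- x\<^sup>2 / 2) \<le> exp (- t\<^sup>2 / 2) * exp (- (x - t)\<^sup>2 / 2)"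
        by (simp flip: exp_add)
      then show ?thesis by (simp add: normal_density_def divide_right_mono)
    qed
    then show "ennreal (std_normal_density x) * indicator {t..} x
        \<le> ennreal (exp (- t\<^sup>2 / 2)) * ennreal (normal_density t 1 x)"
      by (auto simp: indicator_def ennreal_leI simp flip: ennreal_mult)
  qed
  also have "\<dots> = ennreal (exp (- t\<^sup>2 / 2)) * (\<integral>\<^sup>+x. ennreal (normal_density t 1 x) \<partial>lborel)"
    by (intro nn_integral_cmult) auto
  also have "(\<integral>\<^sup>+x. ennreal (normal_density t 1 x) \<partial>lborel) = 1"
    by (subst nn_integral_eq_integral) auto
  finally show ?thesis
    by (simp add: std_normal.emeasure_eq_measure)
qed

lemma gauss_tail_nonneg: "0 \<le> gauss_tail t" and gauss_tail_le_1: "gauss_tail t \<le> 1"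
  by (simp_all add: gauss_tail_def)

lemma gauss_tail_antimono: "s \<le> t \<Longrightarrow> gauss_tail t \<le> gauss_tail s"
  unfolding gauss_tail_def by (intro std_normal.finite_measure_mono) auto

lemma gauss_tail_le: "t \<ge> 0 \<Longrightarrow> gauss_tail t \<le> exp (- t\<^sup>2 / 2)"
  unfolding gauss_tail_def
  by (rule order_trans[OF std_normal.finite_measure_mono std_normal_chernoff]) auto

lemma gauss_tail_minus: "gauss_tail (- t) = 1 - measure std_normal {t..}"
proof -
  have "gauss_tail (- t) = 1 - measure std_normal (UNIV - {-t<..})"
    unfolding gauss_tail_def using std_normal.prob_compl[of "{-t<..}"] by simp
  also have "UNIV - {-t<..} = uminus -` {t..}" by auto
  finally show ?thesis by (simp add: std_normal_reflect)
qed

lemma gauss_tail_0: "gauss_tail 0 = 1 / 2"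
proof -
  have "measure std_normal ({0} \<union> {0<..}) = measure std_normal {0} + measure std_normal {0<..}"
    by (rule std_normal.finite_measure_Union) auto
  moreover have "{0} \<union> {0<..} = {0::real..}" by auto
  ultimately have "measure std_normal {0..} = gauss_tail 0"
    by (simp add: std_normal_singleton gauss_tail_def)
  then show ?thesis using gauss_tail_minus[of 0] by simp
qed

lemma gauss_tail_minus_ge_half: "t \<ge> 0 \<Longrightarrow> 1 / 2 \<le> gauss_tail (- t)"
  using gauss_tail_antimono[of "-t" 0] gauss_tail_0 by simp

text \<open>
  A polynomial bound is enough for the signal components: their thresholds grow geometrically
  from step to step, so the error probabilities are dominated by a geometric series.
\<close>
lemma gauss_tail_minus_ge:
  assumes "t > 0"
  shows "1 - 2 / t\<^sup>2 \<le> gauss_tail (- t)"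
proof -
  have "t\<^sup>2 / 2 \<le> exp (t\<^sup>2 / 2)" using exp_ge_add_one_self[of "t\<^sup>2 / 2"] by linarith
  then have "exp (- (t\<^sup>2 / 2)) \<le> 2 / t\<^sup>2"
    using assms by (simp add: exp_minus field_simps)
  then show ?thesis using std_normal_chernoff[of t] assms by (simp add: gauss_tail_minus)
qed

section \<open>Counting rows of a Gaussian array\<close>


text \<open>
  Pairwise independence makes the variance of the count at most its mean, so Chebyshev's
  inequality applies with \<open>card T * q\<close> in place of the variance.
\<close>
lemma (in prob_space) chebyshev_count:
  fixes A :: "'i \<Rightarrow> 'a set"
  assumes T: "finite T" and A: "\<And>i. i \<in> T \<Longrightarrow> A i \<in> events"
    and q: "\<And>i. i \<in> T \<Longrightarrow> prob (A i) = q"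
    and qq: "\<And>i l. i \<in> T \<Longrightarrow> l \<in> T \<Longrightarrow> i \<noteq> l \<Longrightarrow> prob (A i \<inter> A l) = q * q"
    and a: "a > 0"
  shows "{\<omega> \<in> space M. a \<le> \<bar>real (card {i \<in> T. \<omega> \<in> A i}) - real (card T) * q\<bar>} \<in> events" (is ?meas)
    and "prob {\<omega> \<in> space M. a \<le> \<bar>real (card {i \<in> T. \<omega> \<in> A i}) - real (card T) * q\<bar>}
           \<le> real (card T) * q / a\<^sup>2" (is ?bound)
proof -
  define N where "N = (\<lambda>\<omega>. \<Sum>i\<in>T. indicator (A i) \<omega> :: real)"
  have N: "real (card {i \<in> T. \<omega> \<in> A i}) = N \<omega>" for \<omega>
    using T by (simp add: N_def indicator_def sum.If_cases Int_def)
  have N_sq: "(N \<omega>)\<^sup>2 = (\<Sum>i\<in>T. \<Sum>l\<in>T. indicator (A i \<inter> A l) \<omega>)" for \<omega>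
    by (simp add: N_def power2_eq_square sum_product indicator_inter_arith)
  have mN[measurable]: "N \<in> borel_measurable M"
    using A by (auto simp: N_def)
  have int: "integrable M (indicator (A i) :: _ \<Rightarrow> real)" if "i \<in> T" for i
    using A[OF that] by (simp add: emeasure_eq_measure)
  have int2: "integrable M (indicator (A i \<inter> A l) :: _ \<Rightarrow> real)" if "i \<in> T" "l \<in> T" for i l
    using A that by (simp add: emeasure_eq_measure sets.Int)
  have EN: "expectation N = real (card T) * q"
    using A q int by (simp add: N_def Bochner_Integration.integral_sum sets.Int_space_eq2)
  have iN: "integrable M N" unfolding N_def using int by auto
  have iN2: "integrable M (\<lambda>\<omega>. (N \<omega>)\<^sup>2)" unfolding N_sq using int2 by auto
  have inner: "(\<Sum>l\<in>T. prob (A i \<inter> A l)) = q + (real (card T) - 1) * (q * q)" if i: "i \<in> T" for i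
  proof -
    have "(\<Sum>l\<in>T. prob (A i \<inter> A l)) = prob (A i \<inter> A i) + (\<Sum>l\<in>T - {i}. prob (A i \<inter> A l))"
      using T i by (simp add: sum.remove)
    also have "(\<Sum>l\<in>T - {i}. prob (A i \<inter> A l)) = (\<Sum>l\<in>T - {i}. q * q)"
      using qq i by (intro sum.cong) auto
    also have "\<dots> = real (card T - 1) * (q * q)"
      using T i by simp
    also have "real (card T - 1) = real (card T) - 1"
      using T i by (subst of_nat_diff) (auto simp: Suc_le_eq card_gt_0_iff)
    finally show ?thesis using q i by simp
  qed
  have EN2: "expectation (\<lambda>\<omega>. (N \<omega>)\<^sup>2) = real (card T) * (q + (real (card T) - 1) * (q * q))"
  proof -
    have "expectation (\<lambda>\<omega>. (N \<omega>)\<^sup>2) = (\<Sum>i\<in>T. \<Sum>l\<in>T. expectation (indicator (A i \<inter> A l)))"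
      unfolding N_sq using int2
      by (subst Bochner_Integration.integral_sum, force, intro sum.cong refl)
         (subst Bochner_Integration.integral_sum, auto)
    also have "\<dots> = (\<Sum>i\<in>T. \<Sum>l\<in>T. prob (A i \<inter> A l))"
      using A by (intro sum.cong refl) (simp add: sets.Int sets.Int_space_eq2)
    finally show ?thesis using inner by simp
  qed
  have "variance N = expectation (\<lambda>\<omega>. (N \<omega>)\<^sup>2) - (expectation N)\<^sup>2"
    by (rule variance_eq[OF iN iN2])
  also have "\<dots> = real (card T) * (q - q * q)"
    unfolding EN EN2 by (simp add: algebra_simps power2_eq_square)
  also have "\<dots> \<le> real (card T) * q"
    by (intro mult_left_mono) auto
  finally have "variance N / a\<^sup>2 \<le> real (card T) * q / a\<^sup>2"
    by (intro divide_right_mono) auto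
  then show ?bound
    using Chebyshev_inequality[OF mN iN2 a] unfolding N EN by linarith
  show ?meas unfolding N by measurable
qed

locale normal_array = prob_space M for M :: "'a measure" +
  fixes W :: "nat \<Rightarrow> nat \<Rightarrow> 'a \<Rightarrow> real" and A :: "(nat \<times> nat) set"
  assumes iid: "iid_std_normal M A W"
begin

lemma W_measurable: "(i, j) \<in> A \<Longrightarrow> W i j \<in> borel_measurable M"
  using iid by (auto simp: iid_std_normal_def indep_vars_def2)

lemma prob_W_greater:
  assumes "(i, j) \<in> A"
  shows "prob {\<omega> \<in> space M. W i j \<omega> > t} = gauss_tail t"
proof -
  have "distributed M lborel (W i j) std_normal_density"
    using iid assms by (auto simp: iid_std_normal_def)
  then have "gauss_tail t = measure (distr M lborel (W i j)) {t<..}"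
    by (simp add: gauss_tail_def distributed_def)
  also have "\<dots> = prob (W i j -` {t<..} \<inter> space M)"
    using W_measurable[OF assms] by (subst measure_distr) auto
  also have "W i j -` {t<..} \<inter> space M = {\<omega> \<in> space M. W i j \<omega> > t}" by auto
  finally show ?thesis by simp
qed

lemma events_greater:
  assumes "finite L" "\<And>j. j \<in> L \<Longrightarrow> (i, j) \<in> A"
  shows "{\<omega> \<in> space M. \<forall>j\<in>L. W i j \<omega> > t j} \<in> events"
proof (rule sets.sets_Collect_finite_All[OF _ assms(1)])
  fix j assume "j \<in> L"
  then have [measurable]: "W i j \<in> borel_measurable M" by (intro W_measurable assms(2))
  show "{\<omega> \<in> space M. W i j \<omega> > t j} \<in> events" by measurable
qed

lemma prob_greater_family:
  assumes J: "finite J" "J \<subseteq> A"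
  shows "prob {\<omega> \<in> space M. \<forall>(i, j)\<in>J. W i j \<omega> > t j} = (\<Prod>(i, j)\<in>J. gauss_tail (t j))"
proof (cases "J = {}")
  case False
  have indep: "indep_vars (\<lambda>_. borel) (\<lambda>(i, j). W i j) A"
    using iid by (simp add: iid_std_normal_def)
  have "{\<omega> \<in> space M. \<forall>(i, j)\<in>J. W i j \<omega> > t j} =
      (\<Inter>ij\<in>J. (case ij of (i, j) \<Rightarrow> W i j) -` {t (snd ij)<..} \<inter> space M)"
    using False by (auto simp: case_prod_beta)
  also have "prob \<dots> = (\<Prod>ij\<in>J. prob ((case ij of (i, j) \<Rightarrow> W i j) -` {t (snd ij)<..} \<inter> space M))"
    using indep False J by (rule indep_varsD) auto
  also have "\<dots> = (\<Prod>(i, j)\<in>J. gauss_tail (t j))"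
  proof (rule prod.cong[OF refl], clarify)
    fix i j assume "(i, j) \<in> J"
    then have "prob {\<omega> \<in> space M. W i j \<omega> > t j} = gauss_tail (t j)"
      using J by (intro prob_W_greater) auto
    then show "prob (W i j -` {t (snd (i, j))<..} \<inter> space M) = gauss_tail (t j)"
      by (simp add: vimage_def Int_def conj_commute)
  qed
  finally show ?thesis .
qed (simp add: prob_space)

text \<open>
  The thresholds depend on the column only, so the rows are exchangeable and the number of rows
  that stay above all thresholds is a binomial variable.  Both kinds of component are counted in
  this way: null components with all thresholds 0, signal components with negative thresholds.
\<close>
lemma rows_concentration:
  fixes T :: "nat set" and t :: "nat \<Rightarrow> real"
  assumes T: "finite T" and L: "finite L" and TL: "T \<times> L \<subseteq> A" and a: "a > 0"
  defines "q \<equiv> \<Prod>j\<in>L. gauss_tail (t j)"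
  defines "D \<equiv> {\<omega> \<in> space M. a \<le> \<bar>real (card {i \<in> T. \<forall>j\<in>L. W i j \<omega> > t j}) - real (card T) * q\<bar>}"
  shows "D \<in> events" and "prob D \<le> real (card T) * q / a\<^sup>2"
proof -
  define B where "B = (\<lambda>i. {\<omega> \<in> space M. \<forall>j\<in>L. W i j \<omega> > t j})"
  have B: "B i \<in> events" if "i \<in> T" for i
    unfolding B_def using that TL by (intro events_greater L) auto
  have q: "prob (B i) = q" if "i \<in> T" for i
  proof -
    have "B i = {\<omega> \<in> space M. \<forall>(i, j)\<in>{i} \<times> L. W i j \<omega> > t j}" by (auto simp: B_def)
    also have "prob \<dots> = (\<Prod>(i, j)\<in>{i} \<times> L. gauss_tail (t j))"
      using that TL L by (intro prob_greater_family) auto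
    also have "\<dots> = q" by (simp add: q_def flip: prod.cartesian_product)
    finally show ?thesis .
  qed
  have qq: "prob (B i \<inter> B l) = q * q" if "i \<in> T" "l \<in> T" "i \<noteq> l" for i l
  proof -
    have "B i \<inter> B l = {\<omega> \<in> space M. \<forall>(i, j)\<in>{i, l} \<times> L. W i j \<omega> > t j}" by (auto simp: B_def)
    also have "prob \<dots> = (\<Prod>(i, j)\<in>{i, l} \<times> L. gauss_tail (t j))"
      using that TL L by (intro prob_greater_family) auto
    also have "\<dots> = q * q" using that(3) by (simp add: q_def flip: prod.cartesian_product)
    finally show ?thesis .
  qed
  have D: "D = {\<omega> \<in> space M. a \<le> \<bar>real (card {i \<in> T. \<omega> \<in> B i}) - real (card T) * q\<bar>}"
    unfolding D_def B_def by (intro Collect_cong conj_cong refl) simp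
  show "D \<in> events" unfolding D using T B q qq a by (rule chebyshev_count(1))
  show "prob D \<le> real (card T) * q / a\<^sup>2" unfolding D using T B q qq a by (rule chebyshev_count(2))
qed

end

section \<open>One realisation of Distilled Sensing\<close>


text \<open>
  The observation of a null component is a positive multiple of its noise, so whether it is kept
  depends only on the sign of that noise and not on the precision, hence not on what happens to
  the other components.
\<close>
definition null_survivors :: "nat \<Rightarrow> (nat \<Rightarrow> real) \<Rightarrow> (nat \<Rightarrow> nat \<Rightarrow> real) \<Rightarrow> nat \<Rightarrow> nat set" where
  "null_survivors p x w j = {i \<in> {1..p} - support p x. \<forall>l\<in>{1..<j}. w i l > 0}"

lemma finite_signal_support [simp]: "finite (support p x)"
  by (simp add: support_def)

lemma finite_null_survivors [simp]: "finite (null_survivors p x w j)"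
  by (simp add: null_survivors_def)

lemma ds_index_subset: "ds_index p x R w j \<subseteq> {1..p}"
proof (induction p x R w j rule: ds_index.induct)
  case (3 p x R w j)
  have "ds_index p x R w (Suc (Suc j)) \<subseteq> ds_index p x R w (Suc j)"
    unfolding ds_index.simps by (rule Collect_restrict)
  from this 3(1) show ?case by (rule order_trans)
qed simp_all

lemma finite_ds_index [simp]: "finite (ds_index p x R w j)"
  by (rule finite_subset[OF ds_index_subset]) simp

lemma ds_index_subset_survivors:
  "ds_index p x R w j \<subseteq> support p x \<union> null_survivors p x w j"
proof (induction p x R w j rule: ds_index.induct)
  case (3 p x R w j)
  show ?case
  proof
    fix i assume i: "i \<in> ds_index p x R w (Suc (Suc j))"
    then have i': "i \<in> support p x \<union> null_survivors p x w (Suc j)" using 3 by auto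
    show "i \<in> support p x \<union> null_survivors p x w (Suc (Suc j))"
    proof (cases "i \<in> support p x")
      case False
      then have "x i = 0" using i ds_index_subset[of p x R w "Suc (Suc j)"] by (auto simp: support_def)
      then have "ds_precision R (ds_index p x R w (Suc j)) i (Suc j) powr (- 1 / 2) * w i (Suc j) > 0"
        using i by (simp add: ds_measure_def)
      then have "w i (Suc j) > 0"
        by (metis powr_ge_zero mult_nonneg_nonpos not_le)
      then show ?thesis
        using i' False by (auto simp: null_survivors_def less_Suc_eq)
    qed simp
  qed
qed (auto simp: null_survivors_def)

lemma card_ds_index_le:
  "card (ds_index p x R w j) \<le> card (support p x) + card (null_survivors p x w j)"
  by (rule order_trans[OF card_mono[OF _ ds_index_subset_survivors] card_Un_le]) simp

lemma observation_greater_iff: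
  assumes "\<gamma> > 0"
  shows "u + \<gamma> powr (- 1 / 2) * v > L \<longleftrightarrow> v > (L - u) * sqrt \<gamma>"
proof -
  have "\<gamma> powr (- 1 / 2) = 1 / sqrt \<gamma>"
    using assms powr_minus[of \<gamma> "1 / 2"] by (simp add: powr_half_sqrt inverse_eq_divide)
  then show ?thesis using assms by (simp only:) (simp add: field_simps)
qed

text \<open>
  An upper bound \<open>m\<close> on the number of observed components bounds the precision from below and
  turns the random condition for exceeding the level \<open>L\<close> into a condition on the noise alone.
\<close>
lemma signal_observed:
  assumes i: "i \<in> I" and I: "finite I" "real (card I) \<le> m" and R: "R j > 0"
    and L: "L \<le> x i" and t: "t \<le> (x i - L) * sqrt (R j / m)" and w: "w i j > - t"
  shows "ds_measure x R w I i j > L"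
proof -
  have c: "real (card I) > 0" using i I by (auto simp: card_gt_0_iff)
  then have "R j / m \<le> R j / real (card I)"
    using I R by (intro divide_left_mono) auto
  then have "(x i - L) * sqrt (R j / m) \<le> (x i - L) * sqrt (R j / real (card I))"
    using L by (intro mult_left_mono) auto
  then have "w i j > (L - x i) * sqrt (R j / real (card I))"
    using t w by (simp add: algebra_simps)
  then show ?thesis
    using i c R unfolding ds_measure_def ds_precision_def by (subst observation_greater_iff) auto
qed

lemma signal_survives:
  assumes i: "i \<in> {1..p}" "x i \<ge> 0" and j: "j \<ge> 1"
    and R: "\<And>l. l \<in> {1..<j} \<Longrightarrow> R l > 0"
    and m: "\<And>l. l \<in> {1..<j} \<Longrightarrow> real (card (ds_index p x R w l)) \<le> m l"
    and t: "\<And>l. l \<in> {1..<j} \<Longrightarrow> t l \<le> x i * sqrt (R l / m l)"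
    and w: "\<And>l. l \<in> {1..<j} \<Longrightarrow> w i l > - t l"
  shows "i \<in> ds_index p x R w j"
  using j R m t w
proof (induction j rule: dec_induct)
  case (step j)
  then have IH: "i \<in> ds_index p x R w j" by simp
  have "ds_measure x R w (ds_index p x R w j) i j > 0"
    using step.hyps i
    by (intro signal_observed[where m = "m j" and t = "t j"] IH step.prems finite_ds_index)
       (use step.prems(3)[of j] in auto)
  moreover obtain j' where "j = Suc j'" using step.hyps by (cases j) auto
  ultimately show ?case using IH by simp
qed (use i in simp)

text \<open>
  At the last step the precision is \<open>c * p / card I\<close>.  The constant \<open>c\<close> cancels against the
  cut-off \<open>sqrt (2 / c)\<close>, and the noise of a falsely discovered component must exceed a level
  that grows as the index set thins out.
\<close>
lemma false_discovery_noise: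
  assumes i: "i \<in> S_DS p c x R w" "i \<notin> support p x" and p: "p \<ge> 1" and c: "c > 0"
    and R: "R (ds_steps p) = c * real p"
    and m: "real (card (ds_index p x R w (ds_steps p))) \<le> m"
  shows "w i (ds_steps p) > sqrt (2 * real p / m)"
proof -
  define k I where "k = ds_steps p" and "I = ds_index p x R w k"
  have i': "i \<in> I" "ds_measure x R w I i k > sqrt (2 / c)"
    using i by (auto simp: S_DS_def ds_obs_def k_def I_def)
  have I: "I \<subseteq> {1..p}" "finite I" using ds_index_subset[of p x R w k] by (auto simp: I_def)
  then have x: "x i = 0" using i' i by (auto simp: support_def)
  have cI: "real (card I) > 0" using i' I by (auto simp: card_gt_0_iff)
  have "2 * real p / m \<le> 2 * real p / real (card I)"
    using m cI by (intro divide_left_mono) (auto simp: I_def k_def)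
  also have "2 * real p / real (card I) = 2 / c * (R k / real (card I))"
    using c R by (simp add: k_def)
  finally have "sqrt (2 * real p / m) \<le> sqrt (2 / c) * sqrt (R k / real (card I))"
    by (subst real_sqrt_mult[symmetric]) simp
  also have "\<dots> < w i k"
    using i' x c cI p R observation_greater_iff[of "R k / real (card I)" "sqrt (2 / c)" 0 "w i k"]
    by (simp add: ds_measure_def ds_precision_def k_def)
  finally show ?thesis by (simp add: k_def)
qed

text \<open>
  Measurability has to be shown only for the event whose probability tends to 1: the probabilities
  that tend to 0 are bounded above by those of measurable events.
\<close>
lemma measurable_ds_index:
  assumes W: "\<And>i j. i \<in> {1..p} \<Longrightarrow> j \<in> {1..<k} \<Longrightarrow> W i j \<in> borel_measurable M"
    and "j \<le> k" "i \<in> {1..p}"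
  shows "{\<omega> \<in> space M. i \<in> ds_index p x R (\<lambda>i j. W i j \<omega>) j} \<in> sets M"
  using assms(2,3)
proof (induction j arbitrary: i rule: less_induct)
  case (less j)
  consider "j \<le> 1" | j' where "j = Suc (Suc j')" using less_imp_Suc_add[of 1 j] by fastforce
  then show ?case
  proof cases
    case 1
    then have "ds_index p x R w j = {1..p}" for w by (cases j) auto
    then show ?thesis using less.prems by simp
  next
    case (2 j')
    define I where "I = (\<lambda>\<omega>. ds_index p x R (\<lambda>i j. W i j \<omega>) (Suc j'))"
    have I[measurable]: "Measurable.pred M (\<lambda>\<omega>. i \<in> I \<omega>)" if "i \<in> {1..p}" for i
      using less.IH[of "Suc j'" i] less.prems 2 that by (simp add: pred_def I_def)
    have card: "real (card (I \<omega>)) = (\<Sum>i\<in>{1..p}. if i \<in> I \<omega> then 1 else 0)" for \<omega>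
      using ds_index_subset[of p x R "\<lambda>i j. W i j \<omega>" "Suc j'"]
      by (simp add: sum.If_cases I_def Int_absorb1)
    have [measurable]: "(\<lambda>\<omega>. real (card (I \<omega>))) \<in> borel_measurable M"
      unfolding card by (intro borel_measurable_sum measurable_If I) auto
    have [measurable]: "W i (Suc j') \<in> borel_measurable M"
      using W less.prems 2 by auto
    have "Measurable.pred M (\<lambda>\<omega>. i \<in> I \<omega> \<and> ds_measure x R (\<lambda>i j. W i j \<omega>) (I \<omega>) i (Suc j') > 0)"
      using less.prems unfolding ds_measure_def ds_precision_def by measurable
    then show ?thesis by (simp add: pred_def 2 I_def)
  qed
qed

lemma measurable_S_DS_empty:
  assumes W: "\<And>i j. i \<in> {1..p} \<Longrightarrow> j \<in> {1..ds_steps p} \<Longrightarrow> W i j \<in> borel_measurable M"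
  shows "{\<omega> \<in> space M. S_DS p c x R (\<lambda>i j. W i j \<omega>) = {}} \<in> sets M"
proof -
  define k where "k = ds_steps p"
  define I where "I = (\<lambda>\<omega>. ds_index p x R (\<lambda>i j. W i j \<omega>) k)"
  have I[measurable]: "Measurable.pred M (\<lambda>\<omega>. i \<in> I \<omega>)" if "i \<in> {1..p}" for i
    unfolding pred_def I_def by (rule measurable_ds_index[of p k]) (use W that in \<open>auto simp: k_def\<close>)
  have "k \<ge> 1" by (simp add: k_def ds_steps_def)
  then have [measurable]: "W i k \<in> borel_measurable M" if "i \<in> {1..p}" for i
    using W that by (auto simp: k_def)
  have card: "real (card (I \<omega>)) = (\<Sum>i\<in>{1..p}. if i \<in> I \<omega> then 1 else 0)" for \<omega>
    using ds_index_subset[of p x R "\<lambda>i j. W i j \<omega>" k]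
    by (simp add: sum.If_cases I_def Int_absorb1)
  have [measurable]: "(\<lambda>\<omega>. real (card (I \<omega>))) \<in> borel_measurable M"
    unfolding card by (intro borel_measurable_sum measurable_If I) auto
  have "Measurable.pred M (\<lambda>\<omega>. \<forall>i\<in>{1..p}.
      \<not> (i \<in> I \<omega> \<and> ds_measure x R (\<lambda>i j. W i j \<omega>) (I \<omega>) i k > sqrt (2 / c)))"
    unfolding ds_measure_def ds_precision_def by measurable
  moreover have "S_DS p c x R (\<lambda>i j. W i j \<omega>) = {} \<longleftrightarrow> (\<forall>i\<in>{1..p}.
      \<not> (i \<in> I \<omega> \<and> ds_measure x R (\<lambda>i j. W i j \<omega>) (I \<omega>) i k > sqrt (2 / c)))" for \<omega>
    using ds_index_subset[of p x R "\<lambda>i j. W i j \<omega>" k]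
    unfolding S_DS_def ds_obs_def I_def k_def by blast
  ultimately show ?thesis by (simp add: pred_def)
qed

section \<open>The probability that a signal component persists\<close>


text \<open>
  The probability that the noise of one signal component stays above its thresholds for \<open>k\<close> steps:
  \<open>\<nu>\<close> is proportional to the amplitude of the signal, and the lower bound on the precision of the
  measurements grows by the factor \<open>r\<close> per step.
\<close>
definition persistence :: "real \<Rightarrow> real \<Rightarrow> nat \<Rightarrow> real" where
  "persistence \<nu> r k = (\<Prod>j<k. gauss_tail (- (\<nu> * sqrt (r ^ j))))"

lemma persistence_le_1: "persistence \<nu> r k \<le> 1"
  unfolding persistence_def
  by (auto intro!: prod_le_1 simp: gauss_tail_nonneg gauss_tail_le_1)

lemma persistence_ge:
  assumes \<nu>: "\<nu> > 0" and r: "r > 1"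
  shows "1 - 2 * r / (r - 1) / \<nu>\<^sup>2 \<le> persistence \<nu> r k"
proof -
  have "1 - 2 / \<nu>\<^sup>2 * (\<Sum>j<k. (1 / r) ^ j) \<le> persistence \<nu> r k"
  proof (induction k)
    case (Suc k)
    define g where "g = gauss_tail (- (\<nu> * sqrt (r ^ k)))"
    have "1 - 2 / (\<nu> * sqrt (r ^ k))\<^sup>2 \<le> g"
      unfolding g_def using \<nu> r by (intro gauss_tail_minus_ge) auto
    also have "2 / (\<nu> * sqrt (r ^ k))\<^sup>2 = 2 / \<nu>\<^sup>2 * (1 / r) ^ k"
      using r by (simp add: power_mult_distrib power_one_over)
    finally have g: "1 - g \<le> 2 / \<nu>\<^sup>2 * (1 / r) ^ k" by simp
    have "persistence \<nu> r k * (1 - g) \<le> 1 * (1 - g)"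
      using persistence_le_1 gauss_tail_le_1 by (intro mult_right_mono) (auto simp: g_def)
    then have "persistence \<nu> r k - (1 - g) \<le> persistence \<nu> r k * g"
      by (simp add: algebra_simps)
    also have "\<dots> = persistence \<nu> r (Suc k)" by (simp add: persistence_def g_def)
    finally show ?case using Suc g by (simp add: algebra_simps)
  qed (simp add: persistence_def)
  moreover have "(\<Sum>j<k. (1 / r) ^ j) \<le> r / (r - 1)"
  proof -
    have "(\<Sum>j<k. (1 / r) ^ j) \<le> (\<Sum>j. (1 / r) ^ j)"
      using r by (intro sum_le_suminf summable_geometric) auto
    also have "\<dots> = r / (r - 1)" using r by (subst suminf_geometric) (auto simp: field_simps)
    finally show ?thesis .
  qed
  then have "2 / \<nu>\<^sup>2 * (\<Sum>j<k. (1 / r) ^ j) \<le> 2 / \<nu>\<^sup>2 * (r / (r - 1))"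
    by (intro mult_left_mono) auto
  ultimately show ?thesis by (simp add: mult.commute)
qed

lemma persistence_Suc:
  assumes "r \<ge> 0"
  shows "persistence \<nu> r (Suc k) = gauss_tail (- \<nu>) * persistence (\<nu> * sqrt r) r k"
  using assms by (simp add: persistence_def prod.lessThan_Suc_shift real_sqrt_mult mult.assoc del: prod.lessThan_Suc)

text \<open>
  By the previous bound, the probability is at least 1/2 once \<open>\<nu>\<close> is large.  Splitting off one
  step costs at most a factor 1/2 and multiplies \<open>\<nu>\<close> by \<open>sqrt r\<close>, so finitely many such factors,
  independent of \<open>k\<close>, reach that range.
\<close>
lemma persistence_bounded_below:
  assumes \<nu>: "\<nu> > 0" and r: "r > 1"
  obtains q where "q > 0" "\<And>k. q \<le> persistence \<nu> r k"
proof -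
  define K where "K = 2 * (2 * r / (r - 1))"
  have K: "K > 0" using r by (simp add: K_def)
  have *: "(1 / 2) ^ Suc m \<le> persistence \<nu> r k" if "\<nu> > 0" "K \<le> \<nu>\<^sup>2 * r ^ m" for m \<nu> k
    using that
  proof (induction m arbitrary: \<nu> k)
    case 0
    have "2 * r / (r - 1) = K / 2" by (simp only: K_def nonzero_mult_div_cancel_left zero_neq_numeral not_False_eq_True)
    moreover have "K / 2 / \<nu>\<^sup>2 \<le> 1 / 2" using 0 by (simp add: field_simps)
    ultimately have "2 * r / (r - 1) / \<nu>\<^sup>2 \<le> 1 / 2" by (simp only:)
    then show ?case using persistence_ge[OF 0(1) r, of k] by simp
  next
    case (Suc m)
    show ?case
    proof (cases k)
      case 0
      then show ?thesis by (simp add: persistence_def power_le_one del: power_Suc)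
    next
      case (Suc k')
      have "(1 / 2) ^ Suc m \<le> persistence (\<nu> * sqrt r) r k'"
        using Suc.prems r by (intro Suc.IH) (auto simp: power_mult_distrib mult_ac)
      then have "(1 / 2) * (1 / 2) ^ Suc m \<le> gauss_tail (- \<nu>) * persistence (\<nu> * sqrt r) r k'"
        using Suc.prems gauss_tail_minus_ge_half[of \<nu>] by (intro mult_mono) (auto simp: gauss_tail_nonneg)
      then show ?thesis using r by (simp add: persistence_Suc \<open>k = Suc k'\<close>)
    qed
  qed
  obtain m where "K / \<nu>\<^sup>2 < r ^ m" using real_arch_pow[OF r] by blast
  then have "K \<le> \<nu>\<^sup>2 * r ^ m" using \<nu> by (simp add: field_simps)
  then show ?thesis using * \<nu> by (intro that[of "(1 / 2) ^ Suc m"]) auto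
qed

lemma prod_gauss_tail_eq_persistence:
  "(\<Prod>j\<in>{1..k}. gauss_tail (- (\<nu> * sqrt (r ^ (j - 1))))) = persistence \<nu> r k"
  by (simp add: persistence_def prod.atLeast1_atMost_eq)

section \<open>Probability bounds for one dimension\<close>


text \<open>
  The first term bounds the probability that the null components are thinned out too slowly at
  some step.  The second one is a union bound for the noise of all components at the last step.
\<close>
definition ds_error :: "nat \<Rightarrow> real" where
  "ds_error p = 16 * 2 ^ ds_steps p / real p
     + real p * gauss_tail (sqrt (4 / 3 * 2 ^ (ds_steps p - 1)))"

text \<open>
  The assumption on \<open>R\<close> covers the last step as well: for \<open>\<rho> \<le> 1\<close> it follows from the linear size of
  \<open>R (ds_steps p)\<close>.  The support is required to be a small part of the null components that
  remain at the last step, so that it never dominates the size of an index set.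
\<close>
locale ds_run = normal_array M W "{1..p} \<times> {1..ds_steps p}" for M :: "'a measure" and W p +
  fixes x R :: "nat \<Rightarrow> real" and b c \<rho> :: real
  assumes p: "p \<ge> 1" and b: "b > 0" and c: "c > 0" and \<rho>: "\<rho> > 1 / 2"
    and R_ge: "\<And>j. j \<in> {1..ds_steps p} \<Longrightarrow> b * real p * \<rho> ^ (j - 1) \<le> R j"
    and R_last: "R (ds_steps p) = c * real p"
    and sparse: "real (card (support p x)) \<le> real p / (4 * 2 ^ (ds_steps p - 1))"
begin

abbreviation "w \<omega> \<equiv> \<lambda>i j. W i j \<omega>"
abbreviation "found \<omega> \<equiv> S_DS p c x R (w \<omega>)"

lemma ds_steps_ge: "ds_steps p \<ge> 1"
  by (simp add: ds_steps_def)

text \<open>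
  On average at most \<open>p / 2 ^ (j - 1)\<close> null components survive up to step \<open>j\<close>, and Chebyshev's inequality makes a
  relative excess of 1/4 unlikely; the bounds sum geometrically over the steps.
\<close>
lemma null_survivors_bound:
  "\<exists>E\<in>events. prob E \<le> 16 * 2 ^ ds_steps p / real p \<and>
    (\<forall>\<omega>\<in>space M - E. \<forall>j\<in>{1..ds_steps p}.
       real (card (null_survivors p x (w \<omega>) j)) \<le> 5 / 4 * real p / 2 ^ (j - 1))"
proof -
  define T where "T = {1..p} - support p x"
  define u where "u = (\<lambda>j. real p / 2 ^ (j - 1))"
  define D where "D = (\<lambda>j. {\<omega> \<in> space M. u j / 4 \<le>
    \<bar>real (card {i \<in> T. \<forall>l\<in>{1..<j}. W i l \<omega> > 0}) - real (card T) * (\<Prod>l\<in>{1..<j}. gauss_tail 0)\<bar>})"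
  have u: "u j > 0" for j using p by (simp add: u_def)
  have Tu: "real (card T) * (\<Prod>l\<in>{1..<j}. gauss_tail 0) \<le> u j" for j
  proof -
    have "card T \<le> p" unfolding T_def by (rule order_trans[OF card_mono[of "{1..p}"]]) auto
    then show ?thesis by (simp add: gauss_tail_0 power_one_over u_def divide_right_mono)
  qed
  have D: "D j \<in> events" "prob (D j) \<le> 16 * 2 ^ (j - 1) / real p" if "j \<in> {1..ds_steps p}" for j
  proof -
    show "D j \<in> events"
      unfolding D_def using that u by (intro rows_concentration(1)) (auto simp: T_def)
    have "prob (D j) \<le> real (card T) * (\<Prod>l\<in>{1..<j}. gauss_tail 0) / (u j / 4)\<^sup>2"
      unfolding D_def using that u by (intro rows_concentration(2)) (auto simp: T_def)
    also have "\<dots> \<le> u j / (u j / 4)\<^sup>2"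
      by (intro divide_right_mono Tu) auto
    also have "\<dots> = 16 * 2 ^ (j - 1) / real p"
      using p by (simp add: u_def power2_eq_square field_simps)
    finally show "prob (D j) \<le> 16 * 2 ^ (j - 1) / real p" .
  qed
  show ?thesis
  proof (intro bexI[of _ "\<Union>j\<in>{1..ds_steps p}. D j"] conjI ballI)
    show "(\<Union>j\<in>{1..ds_steps p}. D j) \<in> events" using D by auto
    have "prob (\<Union>j\<in>{1..ds_steps p}. D j) \<le> (\<Sum>j\<in>{1..ds_steps p}. prob (D j))"
      using D by (intro finite_measure_subadditive_finite) auto
    also have "\<dots> \<le> (\<Sum>j\<in>{1..ds_steps p}. 16 * 2 ^ (j - 1) / real p)"
      using D by (intro sum_mono) auto
    also have "\<dots> = 16 / real p * (\<Sum>j<ds_steps p. 2 ^ j)"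
      by (simp add: sum.atLeast1_atMost_eq sum_distrib_left)
    also have "\<dots> \<le> 16 / real p * 2 ^ ds_steps p"
      by (intro mult_left_mono) (auto simp: geometric_sum)
    finally show "prob (\<Union>j\<in>{1..ds_steps p}. D j) \<le> 16 * 2 ^ ds_steps p / real p"
      by simp
  next
    fix \<omega> j assume *: "\<omega> \<in> space M - (\<Union>j\<in>{1..ds_steps p}. D j)" "j \<in> {1..ds_steps p}"
    then have "\<bar>real (card {i \<in> T. \<forall>l\<in>{1..<j}. W i l \<omega> > 0})
        - real (card T) * (\<Prod>l\<in>{1..<j}. gauss_tail 0)\<bar> < u j / 4"
      by (auto simp: D_def not_le)
    then have "real (card {i \<in> T. \<forall>l\<in>{1..<j}. W i l \<omega> > 0}) \<le> 5 / 4 * u j"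
      using Tu[of j] by linarith
    then show "real (card (null_survivors p x (w \<omega>) j)) \<le> 5 / 4 * real p / 2 ^ (j - 1)"
      by (simp add: null_survivors_def T_def u_def)
  qed
qed

lemma card_ds_index_bound:
  assumes "real (card (null_survivors p x (w \<omega>) j)) \<le> 5 / 4 * real p / 2 ^ (j - 1)"
    and "j \<in> {1..ds_steps p}"
  shows "real (card (ds_index p x R (w \<omega>) j)) \<le> 3 / 2 * real p / 2 ^ (j - 1)"
proof -
  have "(2::real) ^ (j - 1) \<le> 2 ^ (ds_steps p - 1)"
    using assms(2) by (intro power_increasing) auto
  then have "real p / (4 * 2 ^ (ds_steps p - 1)) \<le> real p / (4 * 2 ^ (j - 1))"
    by (intro divide_left_mono) auto
  then have "real (card (support p x)) \<le> real p / (4 * 2 ^ (j - 1))"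
    using sparse by (rule order_trans[rotated])
  moreover have "real (card (ds_index p x R (w \<omega>) j))
      \<le> real (card (support p x)) + real (card (null_survivors p x (w \<omega>) j))"
    using card_ds_index_le[of p x R "w \<omega>" j] by linarith
  ultimately have "real (card (ds_index p x R (w \<omega>) j))
      \<le> real p / (4 * 2 ^ (j - 1)) + 5 / 4 * real p / 2 ^ (j - 1)"
    using assms(1) by (blast intro: order_trans add_mono)
  also have "\<dots> = 3 / 2 * real p / 2 ^ (j - 1)" by (simp add: field_simps)
  finally show ?thesis .
qed

lemma precision_bound:
  assumes j: "j \<in> {1..ds_steps p}"
  shows "2 / 3 * b * (2 * \<rho>) ^ (j - 1) \<le> R j / (3 / 2 * real p / 2 ^ (j - 1))"
proof -
  have "2 / 3 * b * (2 * \<rho>) ^ (j - 1) = (b * real p * \<rho> ^ (j - 1)) / (3 / 2 * real p / 2 ^ (j - 1))"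
    using p by (simp add: power_mult_distrib field_simps)
  also have "\<dots> \<le> R j / (3 / 2 * real p / 2 ^ (j - 1))"
    by (intro divide_right_mono R_ge j) auto
  finally show ?thesis .
qed

lemma R_pos: "j \<in> {1..ds_steps p} \<Longrightarrow> R j > 0"
  using R_ge[of j] b p \<rho> by (intro less_le_trans[of 0 "b * real p * \<rho> ^ (j - 1)" "R j"]) auto

text \<open>
  The thresholds are deterministic, which makes the events for different components independent.
  The amplitude is halved in order to also clear the positive cut-off of the last step.
\<close>
definition favourable :: "real \<Rightarrow> nat \<Rightarrow> 'a \<Rightarrow> bool" where
  "favourable \<mu> i \<omega> \<longleftrightarrow> (\<forall>j\<in>{1..ds_steps p}.
     W i j \<omega> > - (\<mu> / 2 * sqrt (2 / 3 * b) * sqrt ((2 * \<rho>) ^ (j - 1))))"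

lemma favourable_signal_found:
  assumes crowd: "\<And>j. j \<in> {1..ds_steps p} \<Longrightarrow>
      real (card (ds_index p x R (w \<omega>) j)) \<le> 3 / 2 * real p / 2 ^ (j - 1)"
    and i: "i \<in> support p x" and \<mu>: "\<mu> > 0" "\<mu> \<le> x i" "2 * sqrt (2 / c) \<le> x i"
    and favourable: "favourable \<mu> i \<omega>"
  shows "i \<in> found \<omega>"
proof -
  let ?t = "\<lambda>j. \<mu> / 2 * sqrt (2 / 3 * b) * sqrt ((2 * \<rho>) ^ (j - 1))"
  let ?m = "\<lambda>j. 3 / 2 * real p / 2 ^ (j - 1)"
  have L: "sqrt (2 / c) > 0" using c by simp
  have t: "?t j \<le> (x i - l) * sqrt (R j / ?m j)"
    if j: "j \<in> {1..ds_steps p}" and l: "l = 0 \<or> l = sqrt (2 / c)" for j l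
  proof -
    have "?t j = \<mu> / 2 * sqrt (2 / 3 * b * (2 * \<rho>) ^ (j - 1))"
      unfolding real_sqrt_mult[of "2 / 3 * b" "(2 * \<rho>) ^ (j - 1)"] by (rule mult.assoc)
    also have "\<dots> \<le> (x i - l) * sqrt (R j / ?m j)"
      using precision_bound[OF j] \<mu> l L b \<rho> by (intro mult_mono real_sqrt_le_mono) auto
    finally show ?thesis .
  qed
  have i': "i \<in> {1..p}" using i by (auto simp: support_def)
  have "i \<in> ds_index p x R (w \<omega>) (ds_steps p)"
    using i' \<mu> favourable R_pos crowd t[of _ 0] ds_steps_ge
    by (intro signal_survives[where t = ?t and m = ?m]) (auto simp: favourable_def)
  moreover from this have "ds_obs p x R (w \<omega>) i (ds_steps p) > sqrt (2 / c)"
    unfolding ds_obs_def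
    using favourable \<mu> L ds_steps_ge crowd R_pos t[of "ds_steps p" "sqrt (2 / c)"]
    by (intro signal_observed[where t = "?t (ds_steps p)" and m = "?m (ds_steps p)"])
       (auto simp: favourable_def)
  ultimately show ?thesis by (simp add: S_DS_def)
qed

lemma prob_some_noise_greater:
  assumes "j \<in> {1..ds_steps p}"
  shows "{\<omega> \<in> space M. \<exists>i\<in>{1..p}. W i j \<omega> > \<tau>} \<in> events" (is "?E \<in> _")
    and "prob {\<omega> \<in> space M. \<exists>i\<in>{1..p}. W i j \<omega> > \<tau>} \<le> real p * gauss_tail \<tau>"
proof -
  define G where "G = (\<lambda>i. {\<omega> \<in> space M. W i j \<omega> > \<tau>})"
  have G: "G i \<in> events" if "i \<in> {1..p}" for i
  proof -
    have [measurable]: "W i j \<in> borel_measurable M" using that assms by (intro W_measurable) auto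
    show ?thesis unfolding G_def by measurable
  qed
  have E: "?E = (\<Union>i\<in>{1..p}. G i)" by (auto simp: G_def)
  then show "?E \<in> events" using G by auto
  have "prob ?E \<le> (\<Sum>i\<in>{1..p}. prob (G i))"
    unfolding E using G by (intro finite_measure_subadditive_finite) auto
  also have "\<dots> = (\<Sum>i\<in>{1..p}. gauss_tail \<tau>)"
    unfolding G_def using assms by (intro sum.cong refl prob_W_greater) auto
  finally show "prob ?E \<le> real p * gauss_tail \<tau>" by simp
qed

text \<open>
  Outside a single event of small probability the output is described by the noise of the
  components separately: no null component is found, and every signal component with favourable
  noise is found.
\<close>
lemma good_event:
  "\<exists>E\<in>events. prob E \<le> ds_error p \<and> (\<forall>\<omega>\<in>space M - E. found \<omega> \<subseteq> support p x \<and>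
     (\<forall>i\<in>support p x. \<forall>\<mu>. 0 < \<mu> \<longrightarrow> \<mu> \<le> x i \<longrightarrow> 2 * sqrt (2 / c) \<le> x i \<longrightarrow>
        favourable \<mu> i \<omega> \<longrightarrow> i \<in> found \<omega>))"
proof -
  obtain E1 where E1: "E1 \<in> events" "prob E1 \<le> 16 * 2 ^ ds_steps p / real p"
    "\<forall>\<omega>\<in>space M - E1. \<forall>j\<in>{1..ds_steps p}.
       real (card (null_survivors p x (w \<omega>) j)) \<le> 5 / 4 * real p / 2 ^ (j - 1)"
    using null_survivors_bound by (elim bexE conjE)
  define \<tau> where "\<tau> = sqrt (4 / 3 * 2 ^ (ds_steps p - 1))"
  define E2 where "E2 = {\<omega> \<in> space M. \<exists>i\<in>{1..p}. W i (ds_steps p) \<omega> > \<tau>}"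
  have k: "ds_steps p \<in> {1..ds_steps p}" using ds_steps_ge by auto
  have E2: "E2 \<in> events" "prob E2 \<le> real p * gauss_tail \<tau>"
    unfolding E2_def by (rule prob_some_noise_greater[OF k])+
  have crowd: "real (card (ds_index p x R (w \<omega>) j)) \<le> 3 / 2 * real p / 2 ^ (j - 1)"
    if "\<omega> \<in> space M - (E1 \<union> E2)" "j \<in> {1..ds_steps p}" for \<omega> j
    using that by (intro card_ds_index_bound E1(3)[rule_format]) auto
  show ?thesis
  proof (intro bexI[of _ "E1 \<union> E2"] conjI ballI allI impI)
    show "E1 \<union> E2 \<in> events" using E1 E2 by auto
    show "prob (E1 \<union> E2) \<le> ds_error p"
      using measure_Un_le[OF E1(1) E2(1)] E1(2) E2(2)
      by (simp add: ds_error_def \<tau>_def)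
    show "found \<omega> \<subseteq> support p x" if \<omega>: "\<omega> \<in> space M - (E1 \<union> E2)" for \<omega>
    proof
      fix i assume i: "i \<in> found \<omega>"
      have "i \<in> {1..p}" using i ds_index_subset by (fastforce simp: S_DS_def)
      show "i \<in> support p x"
      proof (rule ccontr)
        assume "i \<notin> support p x"
        then have "W i (ds_steps p) \<omega> > sqrt (2 * real p / (3 / 2 * real p / 2 ^ (ds_steps p - 1)))"
          using i by (intro false_discovery_noise[OF _ _ p c R_last crowd[OF \<omega> k]])
        also have "2 * real p / (3 / 2 * real p / 2 ^ (ds_steps p - 1)) = 4 / 3 * 2 ^ (ds_steps p - 1)"
          using p by simp
        finally show False using \<omega> \<open>i \<in> {1..p}\<close> by (auto simp: E2_def \<tau>_def)
      qed
    qed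
    show "i \<in> found \<omega>" if "\<omega> \<in> space M - (E1 \<union> E2)" "i \<in> support p x" "0 < \<mu>" "\<mu> \<le> x i"
       "2 * sqrt (2 / c) \<le> x i" "favourable \<mu> i \<omega>" for \<omega> i \<mu>
      using that crowd by (intro favourable_signal_found) auto
  qed
qed

lemma favourable_count:
  fixes \<mu> \<alpha> :: real
  assumes "\<alpha> > 0"
  defines "D \<equiv> {\<omega> \<in> space M. \<alpha> \<le> \<bar>real (card {i \<in> support p x. favourable \<mu> i \<omega>})
      - real (card (support p x)) * persistence (\<mu> / 2 * sqrt (2 / 3 * b)) (2 * \<rho>) (ds_steps p)\<bar>}"
  shows "D \<in> events"
    and "prob D \<le> real (card (support p x)) *
      persistence (\<mu> / 2 * sqrt (2 / 3 * b)) (2 * \<rho>) (ds_steps p) / \<alpha>\<^sup>2"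
proof -
  let ?t = "\<lambda>j. - (\<mu> / 2 * sqrt (2 / 3 * b) * sqrt ((2 * \<rho>) ^ (j - 1)))"
  have TL: "support p x \<times> {1..ds_steps p} \<subseteq> {1..p} \<times> {1..ds_steps p}"
    by (auto simp: support_def)
  note * = rows_concentration[OF finite_signal_support finite_atLeastAtMost TL assms(1), of ?t,
    unfolded prod_gauss_tail_eq_persistence]
  show "D \<in> events" using *(1) by (simp only: D_def favourable_def)
  show "prob D \<le> real (card (support p x)) *
      persistence (\<mu> / 2 * sqrt (2 / 3 * b)) (2 * \<rho>) (ds_steps p) / \<alpha>\<^sup>2"
    using *(2) by (simp only: D_def favourable_def)
qed

text \<open>
  If nothing is found outside the exceptional event, then no signal component has favourable
  noise, and the count deviates from its mean by the whole mean.
\<close>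
lemma prob_nothing_found_le:
  fixes \<mu> q
  assumes x: "\<And>i. i \<in> support p x \<Longrightarrow> \<mu> \<le> x i \<and> 2 * sqrt (2 / c) \<le> x i" and \<mu>: "\<mu> > 0"
    and S: "support p x \<noteq> {}"
    and q: "0 < q" "q \<le> persistence (\<mu> / 2 * sqrt (2 / 3 * b)) (2 * \<rho>) (ds_steps p)"
  shows "prob {\<omega> \<in> space M. found \<omega> = {}} \<le> ds_error p + 1 / (q * real (card (support p x)))"
proof -
  define s Q where "s = real (card (support p x))"
    and "Q = persistence (\<mu> / 2 * sqrt (2 / 3 * b)) (2 * \<rho>) (ds_steps p)"
  define D where "D = {\<omega> \<in> space M. s * Q \<le> \<bar>real (card {i \<in> support p x. favourable \<mu> i \<omega>}) - s * Q\<bar>}"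
  have s: "s > 0" using S by (simp add: s_def card_gt_0_iff)
  have sQ: "s * Q > 0" using s q by (simp add: Q_def)
  have D: "D \<in> events" "prob D \<le> s * Q / (s * Q)\<^sup>2"
    unfolding D_def s_def Q_def by (rule favourable_count[OF sQ[unfolded s_def Q_def]])+
  obtain E where E: "E \<in> events" "prob E \<le> ds_error p"
    "\<forall>\<omega>\<in>space M - E. found \<omega> \<subseteq> support p x \<and>
     (\<forall>i\<in>support p x. \<forall>\<mu>. 0 < \<mu> \<longrightarrow> \<mu> \<le> x i \<longrightarrow> 2 * sqrt (2 / c) \<le> x i \<longrightarrow>
        favourable \<mu> i \<omega> \<longrightarrow> i \<in> found \<omega>)"
    using good_event by (elim bexE conjE)
  have found: "i \<in> found \<omega>" if "\<omega> \<in> space M - E" "i \<in> support p x" "favourable \<mu> i \<omega>" for \<omega> i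
    using E(3) x[OF that(2)] \<mu> that by blast
  have "{\<omega> \<in> space M. found \<omega> = {}} \<subseteq> E \<union> D"
  proof
    fix \<omega> assume \<omega>: "\<omega> \<in> {\<omega> \<in> space M. found \<omega> = {}}"
    have "\<omega> \<in> D" if "\<omega> \<notin> E"
    proof -
      have "{i \<in> support p x. favourable \<mu> i \<omega>} = {}" using found[of \<omega>] that \<omega> by blast
      then have "real (card {i \<in> support p x. favourable \<mu> i \<omega>}) = 0"
        by (simp only: card.empty of_nat_0)
      then have "s * Q \<le> \<bar>real (card {i \<in> support p x. favourable \<mu> i \<omega>}) - s * Q\<bar>"
        using sQ by linarith
      then show ?thesis using \<omega> unfolding D_def by blast
    qed
    then show "\<omega> \<in> E \<union> D" by blast
  qed
  then have "prob {\<omega> \<in> space M. found \<omega> = {}} \<le> prob (E \<union> D)"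
    using E D by (intro finite_measure_mono) auto
  also have "\<dots> \<le> prob E + prob D" by (rule measure_Un_le[OF E(1) D(1)])
  also have "s * Q / (s * Q)\<^sup>2 = 1 / (s * Q)" using sQ by (simp add: power2_eq_square)
  then have "prob D \<le> 1 / (s * Q)" using D by simp
  also have "1 / (s * Q) \<le> 1 / (q * s)"
    using q s by (intro divide_left_mono) (auto simp: Q_def mult.commute)
  finally show ?thesis using E by (simp add: s_def)
qed

lemma prob_NDP_greater_le:
  fixes \<mu> \<epsilon>
  assumes x: "\<And>i. i \<in> support p x \<Longrightarrow> \<mu> \<le> x i \<and> 2 * sqrt (2 / c) \<le> x i" and \<mu>: "\<mu> > 0"
    and S: "support p x \<noteq> {}" and \<epsilon>: "\<epsilon> > 0"
    and q: "1 - \<epsilon> / 2 \<le> persistence (\<mu> / 2 * sqrt (2 / 3 * b)) (2 * \<rho>) (ds_steps p)"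
  shows "prob {\<omega> \<in> space M. NDP (support p x) (found \<omega>) > \<epsilon>}
    \<le> ds_error p + 4 / (\<epsilon>\<^sup>2 * real (card (support p x)))"
proof -
  define s Q where "s = real (card (support p x))"
    and "Q = persistence (\<mu> / 2 * sqrt (2 / 3 * b)) (2 * \<rho>) (ds_steps p)"
  define D where "D = {\<omega> \<in> space M. \<epsilon> * s / 2 \<le> \<bar>real (card {i \<in> support p x. favourable \<mu> i \<omega>}) - s * Q\<bar>}"
  have s: "s > 0" using S by (simp add: s_def card_gt_0_iff)
  have a: "\<epsilon> * s / 2 > 0" using s \<epsilon> by simp
  have D: "D \<in> events" "prob D \<le> s * Q / (\<epsilon> * s / 2)\<^sup>2"
    unfolding D_def s_def Q_def by (rule favourable_count[OF a[unfolded s_def]])+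
  obtain E where E: "E \<in> events" "prob E \<le> ds_error p"
    "\<forall>\<omega>\<in>space M - E. found \<omega> \<subseteq> support p x \<and>
     (\<forall>i\<in>support p x. \<forall>\<mu>. 0 < \<mu> \<longrightarrow> \<mu> \<le> x i \<longrightarrow> 2 * sqrt (2 / c) \<le> x i \<longrightarrow>
        favourable \<mu> i \<omega> \<longrightarrow> i \<in> found \<omega>)"
    using good_event by (elim bexE conjE)
  have found: "i \<in> found \<omega>" if "\<omega> \<in> space M - E" "i \<in> support p x" "favourable \<mu> i \<omega>" for \<omega> i
    using E(3) x[OF that(2)] \<mu> that by blast
  have "{\<omega> \<in> space M. NDP (support p x) (found \<omega>) > \<epsilon>} \<subseteq> E \<union> D"
  proof
    fix \<omega> assume \<omega>: "\<omega> \<in> {\<omega> \<in> space M. NDP (support p x) (found \<omega>) > \<epsilon>}"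
    have "\<omega> \<in> D" if "\<omega> \<notin> E"
    proof -
      let ?N = "{i \<in> support p x. favourable \<mu> i \<omega>}"
      have "card (support p x - found \<omega>) \<le> card (support p x - ?N)"
        using found[of \<omega>] that \<omega> by (intro card_mono) auto
      also have "\<dots> = card (support p x) - card ?N" by (intro card_Diff_subset) auto
      finally have "real (card (support p x - found \<omega>)) \<le> s - real (card ?N)"
        using card_mono[of "support p x" ?N] by (simp add: s_def)
      moreover have "\<epsilon> * s < real (card (support p x - found \<omega>))"
        using \<omega> s by (simp add: NDP_def s_def field_simps)
      moreover have "s * (1 - \<epsilon> / 2) \<le> s * Q" using q s by (simp add: Q_def)
      ultimately have "\<epsilon> * s / 2 \<le> s * Q - real (card ?N)" by (simp add: algebra_simps)
      then have "\<epsilon> * s / 2 \<le> \<bar>real (card ?N) - s * Q\<bar>" by linarith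
      then show ?thesis using \<omega> unfolding D_def by blast
    qed
    then show "\<omega> \<in> E \<union> D" by blast
  qed
  then have "prob {\<omega> \<in> space M. NDP (support p x) (found \<omega>) > \<epsilon>} \<le> prob (E \<union> D)"
    using E D by (intro finite_measure_mono) auto
  also have "\<dots> \<le> prob E + prob D" by (rule measure_Un_le[OF E(1) D(1)])
  also have "s * Q / (\<epsilon> * s / 2)\<^sup>2 \<le> s * 1 / (\<epsilon> * s / 2)\<^sup>2"
    using s persistence_le_1 by (intro divide_right_mono mult_left_mono) (auto simp: Q_def)
  then have "prob D \<le> s * 1 / (\<epsilon> * s / 2)\<^sup>2" using D by simp
  also have "\<dots> = 4 / (\<epsilon>\<^sup>2 * s)" using s \<epsilon> by (simp add: power2_eq_square field_simps)
  finally show ?thesis using E by (simp add: s_def)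
qed

text \<open>
  A non-measurable set has measure 0 by convention, so the bound holds for an arbitrary
  predicate \<open>P\<close>.
\<close>
lemma prob_false_discovery_le:
  assumes P: "\<And>\<omega>. \<omega> \<in> space M \<Longrightarrow> P \<omega> \<Longrightarrow> \<not> found \<omega> \<subseteq> support p x"
  shows "prob {\<omega> \<in> space M. P \<omega>} \<le> ds_error p"
proof -
  obtain E where E: "E \<in> events" "prob E \<le> ds_error p"
    "\<forall>\<omega>\<in>space M - E. found \<omega> \<subseteq> support p x \<and>
     (\<forall>i\<in>support p x. \<forall>\<mu>. 0 < \<mu> \<longrightarrow> \<mu> \<le> x i \<longrightarrow> 2 * sqrt (2 / c) \<le> x i \<longrightarrow>
        favourable \<mu> i \<omega> \<longrightarrow> i \<in> found \<omega>)"
    using good_event by (elim bexE conjE)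
  have "prob {\<omega> \<in> space M. P \<omega>} \<le> prob E"
    using E P by (intro finite_measure_mono) blast+
  then show ?thesis using E by simp
qed

end

section \<open>Growth of the parameters with the dimension\<close>
lemma ds_steps_bounds:
  assumes "p \<ge> 3"
  shows "2 * ln (real p) \<le> 2 ^ (ds_steps p - 1)" and "2 ^ ds_steps p \<le> 8 * ln (real p)"
proof -
  define L where "L = ln (real p)"
  have "exp 1 \<le> real p" using exp_le assms by linarith
  then have L: "L \<ge> 1" using ln_ge_iff[of "real p" 1] assms by (simp add: L_def)
  define y where "y = log 2 L"
  have y: "y \<ge> 0" "2 powr y = L" using L by (simp_all add: y_def)
  define n where "n = nat \<lceil>y\<rceil>"
  have n: "y \<le> real n" "real n \<le> y + 1" using y by (simp_all add: n_def)
  have "L \<le> 2 powr real n" using n y powr_mono[of y "real n" 2] by simp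
  then have 1: "L \<le> 2 ^ n" by (simp add: powr_realpow)
  have "2 powr real n \<le> 2 powr (y + 1)" using n by (intro powr_mono) auto
  also have "\<dots> = 2 * L" using y by (simp add: powr_add)
  finally have 2: "2 ^ n \<le> 2 * L" by (simp add: powr_realpow)
  have "\<lceil>y\<rceil> \<ge> 0" using y by (simp add: zero_le_ceiling)
  then have k: "ds_steps p = n + 2"
    by (simp add: ds_steps_def n_def y_def L_def)
  show "2 * ln (real p) \<le> 2 ^ (ds_steps p - 1)" "2 ^ ds_steps p \<le> 8 * ln (real p)"
    using 1 2 by (simp_all add: k flip: L_def)
qed

lemma ds_error_tendsto_0: "ds_error \<longlonglongrightarrow> 0"
proof (rule tendsto_sandwich[OF _ _ tendsto_const])
  show "\<forall>\<^sub>F p in sequentially. 0 \<le> ds_error p"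
    by (simp add: ds_error_def gauss_tail_nonneg)
  show "\<forall>\<^sub>F p in sequentially. ds_error p \<le> 128 * ln (real p) / real p + real p * exp (- 4 / 3 * ln (real p))"
    using eventually_ge_at_top[of 3]
  proof eventually_elim
    case (elim p)
    have "16 * 2 ^ ds_steps p / real p \<le> 16 * (8 * ln (real p)) / real p"
      using ds_steps_bounds[OF elim] by (intro divide_right_mono mult_left_mono) auto
    moreover have "gauss_tail (sqrt (4 / 3 * 2 ^ (ds_steps p - 1))) \<le> exp (- 4 / 3 * ln (real p))"
      using ds_steps_bounds(1)[OF elim] by (intro order_trans[OF gauss_tail_le]) auto
    then have "real p * gauss_tail (sqrt (4 / 3 * 2 ^ (ds_steps p - 1))) \<le> real p * exp (- 4 / 3 * ln (real p))"
      by (intro mult_left_mono) auto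
    ultimately show ?case by (simp add: ds_error_def)
  qed
  show "(\<lambda>p. 128 * ln (real p) / real p + real p * exp (- 4 / 3 * ln (real p))) \<longlonglongrightarrow> 0"
    by real_asymp
qed

lemma sparse_signal_card:
  assumes "sparse_signal p \<beta> m x"
  shows "real p powr (1 - \<beta>) - 1 \<le> real (card (support p x))"
    and "real (card (support p x)) \<le> real p powr (1 - \<beta>) + 1"
proof -
  have "real p powr (1 - \<beta>) \<ge> 0" by simp
  then show "real p powr (1 - \<beta>) - 1 \<le> real (card (support p x))"
    and "real (card (support p x)) \<le> real p powr (1 - \<beta>) + 1"
    using assms unfolding sparse_signal_def by (auto simp: of_nat_nat) linarith+
qed

lemma eventually_support_small:
  assumes "0 < \<beta>" "\<beta> < 1"
  shows "\<forall>\<^sub>F p in sequentially. \<forall>x. real (card (support p x)) \<le> real p powr (1 - \<beta>) + 1 \<longrightarrow>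
    real (card (support p x)) \<le> real p / (4 * 2 ^ (ds_steps p - 1))"
proof -
  have "\<forall>\<^sub>F p in sequentially. real p powr (1 - \<beta>) + 1 \<le> real p / (16 * ln (real p))"
    using assms by real_asymp
  then show ?thesis using eventually_ge_at_top[of 3]
  proof eventually_elim
    case (elim p)
    have "(2::real) * 2 ^ (ds_steps p - 1) = 2 ^ ds_steps p"
      by (simp add: ds_steps_def flip: power_Suc)
    then have "4 * 2 ^ (ds_steps p - 1) \<le> 16 * ln (real p)"
      using ds_steps_bounds(2)[OF elim(2)] by simp
    then have "real p / (16 * ln (real p)) \<le> real p / (4 * 2 ^ (ds_steps p - 1))"
      by (intro divide_left_mono) (auto intro!: mult_pos_pos simp: elim less_le_trans[OF _ \<open>3 \<le> p\<close>])
    then show ?case using elim by force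
  qed
qed

lemma geometric_growth_bound:
  fixes R :: "nat \<Rightarrow> real"
  assumes pos: "\<And>j. j \<in> {1..k} \<Longrightarrow> R j > 0"
    and growth: "\<And>j. j \<in> {1..k - 2} \<Longrightarrow> R (j + 1) / R j \<ge> \<delta>"
    and j: "j \<in> {1..k - 1}" and \<rho>: "0 \<le> \<rho>" "\<rho> \<le> \<delta>"
  shows "R 1 * \<rho> ^ (j - 1) \<le> R j"
proof -
  from j have "1 \<le> j" "j \<le> k - 1" by auto
  then show ?thesis
  proof (induction j rule: dec_induct)
    case (step j)
    have R: "R j > 0" using step by (intro pos) auto
    have "R 1 > 0" using step by (intro pos) auto
    moreover have "R 1 * \<rho> ^ (j - 1) \<le> R j" using step by auto
    ultimately have "\<rho> * (R 1 * \<rho> ^ (j - 1)) \<le> \<delta> * R j"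
      using \<rho> by (intro mult_mono) auto
    also have "\<dots> \<le> R (j + 1)"
      using growth[of j] step R by (simp add: field_simps)
    finally show ?case using step by (cases j) (auto simp: mult_ac)
  qed simp
qed

section \<open>Consistency of Distilled Sensing\<close>

theorem mainTheorem1:
  fixes \<beta> \<delta> c\<^sub>1 c\<^sub>k :: real
    and R :: "nat \<Rightarrow> nat \<Rightarrow> real"
    and M :: "nat \<Rightarrow> 'a measure"
    and W :: "nat \<Rightarrow> nat \<Rightarrow> nat \<Rightarrow> 'a \<Rightarrow> real"
  assumes "0 < \<beta>" "\<beta> < 1" "\<delta> > 1 / 2"
    and "0 < c\<^sub>1" "c\<^sub>1 < 1" "0 < c\<^sub>k" "c\<^sub>k < 1"
    and "\<And>p j. p \<ge> 1 \<Longrightarrow> j \<in> {1..ds_steps p} \<Longrightarrow> R p j > 0"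
    and "\<And>p. p \<ge> 1 \<Longrightarrow> (\<Sum>j = 1..ds_steps p. R p j) \<le> real p"
    and "\<And>p j. p \<ge> 1 \<Longrightarrow> j \<in> {1..ds_steps p - 2} \<Longrightarrow> R p (j + 1) / R p j \<ge> \<delta>"
    and "\<And>p. p \<ge> 1 \<Longrightarrow> R p 1 = c\<^sub>1 * real p"
    and "\<And>p. p \<ge> 1 \<Longrightarrow> R p (ds_steps p) = c\<^sub>k * real p"
    and "\<And>p. p \<ge> 1 \<Longrightarrow> prob_space (M p)"
    and "\<And>p. p \<ge> 1 \<Longrightarrow> iid_std_normal (M p) ({1..p} \<times> {1..ds_steps p}) (W p)"
  defines "S \<equiv> \<lambda>p x \<omega>. S_DS p c\<^sub>k x (R p) (\<lambda>i j. W p i j \<omega>)"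
  shows
    "(\<forall>\<mu> x. (\<forall>p\<ge>1. \<mu> p > 0 \<and> sparse_signal p \<beta> (\<mu> p) (x p)) \<longrightarrow>
        filterlim \<mu> at_top sequentially \<longrightarrow>
          tendsto_in_prob M (\<lambda>p \<omega>. FDP (support p (x p)) (S p (x p) \<omega>)) 0 \<and>
          tendsto_in_prob M (\<lambda>p \<omega>. NDP (support p (x p)) (S p (x p) \<omega>)) 0) \<and>
     (\<forall>\<mu>. (\<forall>p\<ge>1. \<mu> p > max (sqrt (4 / c\<^sub>1)) (2 * sqrt (2 / c\<^sub>k))) \<longrightarrow>
        ((\<lambda>p. measure (M p) {\<omega> \<in> space (M p). S p (\<lambda>_. 0) \<omega> = {}}) \<longlonglongrightarrow> 1) \<and>
        (\<forall>x. (\<forall>p\<ge>1. sparse_signal p \<beta> (\<mu> p) (x p)) \<longrightarrow>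
          ((\<lambda>p. measure (M p) {\<omega> \<in> space (M p). S p (x p) \<omega> = {}}) \<longlonglongrightarrow> 0)))"
proof -
  note \<beta> = assms(1,2) and c = assms(4,6) and pos = assms(8) and growth = assms(10)
    and R1 = assms(11) and Rk = assms(12) and M = assms(13) and W = assms(14)
  define b where "b = min c\<^sub>1 c\<^sub>k"
  \<comment> \<open>Capping the growth rate at 1 lets one lower bound on \<open>R p\<close> serve the last step too.\<close>
  define \<rho> where "\<rho> = min \<delta> 1"
  define \<kappa> where "\<kappa> = sqrt (2 / 3 * b)"
  have b: "b > 0" and \<rho>: "1 / 2 < \<rho>" "\<rho> \<le> 1" "\<rho> \<le> \<delta>" and \<kappa>: "\<kappa> > 0"
    using assms(3) c by (auto simp: b_def \<rho>_def \<kappa>_def)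
  have R_ge: "b * real p * \<rho> ^ (j - 1) \<le> R p j" if p: "p \<ge> 1" and j: "j \<in> {1..ds_steps p}" for p j
  proof (cases "j = ds_steps p")
    case True
    have "b * real p * \<rho> ^ (j - 1) \<le> c\<^sub>k * real p * 1"
      using \<rho> b c by (intro mult_mono power_le_one) (auto simp: b_def)
    then show ?thesis using True Rk[OF p] by simp
  next
    case False
    have "b * real p * \<rho> ^ (j - 1) \<le> R p 1 * \<rho> ^ (j - 1)"
      unfolding R1[OF p] using \<rho> by (intro mult_right_mono) (auto simp: b_def)
    also have "\<dots> \<le> R p j"
      using False j \<rho> pos[OF p] growth[OF p]
      by (intro geometric_growth_bound[of "ds_steps p" "R p" \<delta>]) auto
    finally show ?thesis .
  qed
  have run: "\<forall>\<^sub>F p in sequentially. p \<ge> 1 \<and> (\<forall>x. real (card (support p x)) \<le> real p powr (1 - \<beta>) + 1 \<longrightarrow>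
      ds_run (M p) (W p) p x (R p) b c\<^sub>k \<rho>)"
    using eventually_support_small[OF \<beta>] eventually_ge_at_top[of 1]
  proof eventually_elim
    case (elim p)
    then show ?case
      using M[of p] W[of p] b c \<rho> R_ge[of p] Rk[of p]
      by (auto simp: ds_run_def normal_array_def normal_array_axioms_def ds_run_axioms_def)
  qed
  have card_at_top: "filterlim (\<lambda>p. real (card (support p (x p)))) at_top sequentially"
    if "\<forall>p\<ge>1. sparse_signal p \<beta> (\<mu> p) (x p)" for \<mu> x
  proof (rule filterlim_at_top_mono)
    show "filterlim (\<lambda>p. real p powr (1 - \<beta>) - 1) at_top sequentially"
      using \<beta> by real_asymp
    show "\<forall>\<^sub>F p in sequentially. real p powr (1 - \<beta>) - 1 \<le> real (card (support p (x p)))"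
      using eventually_ge_at_top[of 1] by eventually_elim (use that sparse_signal_card in blast)
  qed
  have error_0: "(\<lambda>p. ds_error p + C / real (card (support p (x p)))) \<longlonglongrightarrow> 0"
    if "\<forall>p\<ge>1. sparse_signal p \<beta> (\<mu> p) (x p)" for \<mu> x C
    using tendsto_add[OF ds_error_tendsto_0 tendsto_divide_0[OF tendsto_const
      filterlim_at_top_imp_at_infinity[OF card_at_top[OF that]]]] by simp
  have runs: "\<forall>\<^sub>F p in sequentially. p \<ge> 1 \<and> support p (x p) \<noteq> {} \<and> (\<forall>i\<in>support p (x p). x p i = \<mu> p) \<and>
      ds_run (M p) (W p) p (x p) (R p) b c\<^sub>k \<rho>"
    if "\<forall>p\<ge>1. sparse_signal p \<beta> (\<mu> p) (x p)" for \<mu> x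
    using run filterlim_at_top_dense[THEN iffD1, rule_format, OF card_at_top[OF that], of 0]
  proof eventually_elim
    case (elim p)
    then have sp: "sparse_signal p \<beta> (\<mu> p) (x p)" using that by blast
    moreover have "support p (x p) \<noteq> {}" using elim by force
    ultimately show ?case
      using elim sparse_signal_card(2)[OF sp] unfolding sparse_signal_def by blast
  qed

  have FDP: "tendsto_in_prob M (\<lambda>p \<omega>. FDP (support p (x p)) (S p (x p) \<omega>)) 0"
    if sp: "\<forall>p\<ge>1. sparse_signal p \<beta> (\<mu> p) (x p)" for \<mu> x
    unfolding tendsto_in_prob_def
  proof (intro allI impI)
    fix \<epsilon> :: real assume \<epsilon>: "\<epsilon> > 0"
    show "(\<lambda>p. measure (M p) {\<omega> \<in> space (M p). \<bar>FDP (support p (x p)) (S p (x p) \<omega>) - 0\<bar> > \<epsilon>}) \<longlonglongrightarrow> 0"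
    proof (rule tendsto_sandwich[OF _ _ tendsto_const ds_error_tendsto_0])
      show "\<forall>\<^sub>F p in sequentially.
        measure (M p) {\<omega> \<in> space (M p). \<bar>FDP (support p (x p)) (S p (x p) \<omega>) - 0\<bar> > \<epsilon>} \<le> ds_error p"
        using runs[OF sp]
      proof eventually_elim
        case (elim p)
        interpret ds_run "M p" "W p" p "x p" "R p" b c\<^sub>k \<rho> using elim by blast
        show ?case
        proof (rule prob_false_discovery_le)
          fix \<omega> assume "\<bar>FDP (support p (x p)) (S p (x p) \<omega>) - 0\<bar> > \<epsilon>"
          then have "FDP (support p (x p)) (S p (x p) \<omega>) \<noteq> 0" using \<epsilon> by linarith
          then have "S p (x p) \<omega> - support p (x p) \<noteq> {}"
            unfolding FDP_def by (metis card.empty of_nat_0 div_0)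
          then show "\<not> found \<omega> \<subseteq> support p (x p)" by (auto simp: S_def)
        qed
      qed
    qed simp
  qed
  have NDP: "tendsto_in_prob M (\<lambda>p \<omega>. NDP (support p (x p)) (S p (x p) \<omega>)) 0"
    if sp: "\<forall>p\<ge>1. sparse_signal p \<beta> (\<mu> p) (x p)" and lim: "filterlim \<mu> at_top sequentially" for \<mu> x
    unfolding tendsto_in_prob_def
  proof (intro allI impI)
    fix \<epsilon> :: real assume \<epsilon>: "\<epsilon> > 0"
    define C where "C = 2 * (2 * \<rho>) / (2 * \<rho> - 1)"
    have "((\<lambda>m. C / (m / 2 * \<kappa>)\<^sup>2) \<longlongrightarrow> 0) at_top"
      using \<kappa> by real_asymp
    from filterlim_compose[OF this lim]
    have "\<forall>\<^sub>F p in sequentially. C / (\<mu> p / 2 * \<kappa>)\<^sup>2 < \<epsilon> / 2"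
      by (rule order_tendstoD) (use \<epsilon> in simp)
    moreover have "\<forall>\<^sub>F p in sequentially. 2 * sqrt (2 / c\<^sub>k) \<le> \<mu> p"
      using lim unfolding filterlim_at_top by blast
    moreover have "\<forall>\<^sub>F p in sequentially. 0 < \<mu> p"
      using filterlim_at_top_dense[THEN iffD1, rule_format, OF lim] .
    ultimately have bound: "\<forall>\<^sub>F p in sequentially.
        measure (M p) {\<omega> \<in> space (M p). \<bar>NDP (support p (x p)) (S p (x p) \<omega>) - 0\<bar> > \<epsilon>}
          \<le> ds_error p + (4 / \<epsilon>\<^sup>2) / real (card (support p (x p)))"
      using runs[OF sp]
    proof eventually_elim
      case (elim p)
      interpret ds_run "M p" "W p" p "x p" "R p" b c\<^sub>k \<rho> using elim by blast
      have "1 - C / (\<mu> p / 2 * \<kappa>)\<^sup>2 \<le> persistence (\<mu> p / 2 * \<kappa>) (2 * \<rho>) (ds_steps p)"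
        unfolding C_def using elim \<kappa> \<rho> by (intro persistence_ge) auto
      then have "1 - \<epsilon> / 2 \<le> persistence (\<mu> p / 2 * \<kappa>) (2 * \<rho>) (ds_steps p)"
        using elim by linarith
      then have "measure (M p) {\<omega> \<in> space (M p). NDP (support p (x p)) (found \<omega>) > \<epsilon>}
          \<le> ds_error p + 4 / (\<epsilon>\<^sup>2 * real (card (support p (x p))))"
        unfolding \<kappa>_def using elim \<epsilon> by (intro prob_NDP_greater_le[of "\<mu> p"]) auto
      moreover have "\<bar>NDP (support p (x p)) (found \<omega>) - 0\<bar> = NDP (support p (x p)) (found \<omega>)" for \<omega>
        by (simp add: NDP_def)
      ultimately show ?case by (simp add: S_def)
    qed
    show "(\<lambda>p. measure (M p) {\<omega> \<in> space (M p). \<bar>NDP (support p (x p)) (S p (x p) \<omega>) - 0\<bar> > \<epsilon>}) \<longlonglongrightarrow> 0"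
      by (rule tendsto_sandwich[OF _ bound tendsto_const error_0[OF sp]]) simp
  qed
  have zero: "(\<lambda>p. measure (M p) {\<omega> \<in> space (M p). S p (\<lambda>_. 0) \<omega> = {}}) \<longlonglongrightarrow> 1"
  proof (rule tendsto_sandwich)
    show "\<forall>\<^sub>F p in sequentially. 1 - ds_error p \<le> measure (M p) {\<omega> \<in> space (M p). S p (\<lambda>_. 0) \<omega> = {}}"
      using run
    proof eventually_elim
      case (elim p)
      have supp: "support p (\<lambda>_. 0) = {}" by (simp add: support_def)
      then interpret ds_run "M p" "W p" p "\<lambda>_. 0" "R p" b c\<^sub>k \<rho> using elim by auto
      have m: "{\<omega> \<in> space (M p). found \<omega> = {}} \<in> events"
        by (intro measurable_S_DS_empty W_measurable) auto
      have "measure (M p) {\<omega> \<in> space (M p). \<not> found \<omega> = {}} \<le> ds_error p"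
        by (rule prob_false_discovery_le) (simp add: supp)
      then show ?case using prob_neg[OF m] by (simp add: S_def)
    qed
    show "\<forall>\<^sub>F p in sequentially. measure (M p) {\<omega> \<in> space (M p). S p (\<lambda>_. 0) \<omega> = {}} \<le> 1"
      using eventually_ge_at_top[of 1] by eventually_elim (simp add: M prob_space.prob_le_1)
    show "(\<lambda>p. 1 - ds_error p) \<longlonglongrightarrow> 1"
      using tendsto_diff[OF tendsto_const ds_error_tendsto_0] by force
  qed simp
  have nonzero: "(\<lambda>p. measure (M p) {\<omega> \<in> space (M p). S p (x p) \<omega> = {}}) \<longlonglongrightarrow> 0"
    if sp: "\<forall>p\<ge>1. sparse_signal p \<beta> (\<mu> p) (x p)" and \<mu>: "\<forall>p\<ge>1. \<mu> p \<ge> 2 * sqrt (2 / c\<^sub>k)" for \<mu> x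
  proof -
    \<comment> \<open>The amplitudes may vary with \<open>p\<close>; thresholds built from a common lower bound do not.\<close>
    define m where "m = 2 * sqrt (2 / c\<^sub>k)"
    have m: "m > 0" using c by (simp add: m_def)
    obtain q where q: "q > 0" "\<And>k. q \<le> persistence (m / 2 * \<kappa>) (2 * \<rho>) k"
      using persistence_bounded_below[of "m / 2 * \<kappa>" "2 * \<rho>"] m \<kappa> \<rho> by auto
    have bound: "\<forall>\<^sub>F p in sequentially. measure (M p) {\<omega> \<in> space (M p). S p (x p) \<omega> = {}}
        \<le> ds_error p + (1 / q) / real (card (support p (x p)))"
      using runs[OF sp]
    proof eventually_elim
      case (elim p)
      interpret ds_run "M p" "W p" p "x p" "R p" b c\<^sub>k \<rho> using elim by blast
      have "measure (M p) {\<omega> \<in> space (M p). found \<omega> = {}}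
          \<le> ds_error p + 1 / (q * real (card (support p (x p))))"
        using elim \<mu> m q unfolding \<kappa>_def by (intro prob_nothing_found_le[of m]) (auto simp: m_def)
      then show ?case by (simp add: S_def)
    qed
    show ?thesis
      by (rule tendsto_sandwich[OF _ bound tendsto_const error_0[OF sp]]) simp
  qed
  show ?thesis
  proof (intro conjI allI impI)
    fix \<mu> x assume "\<forall>p\<ge>1. \<mu> p > 0 \<and> sparse_signal p \<beta> (\<mu> p) (x p)" "filterlim \<mu> at_top sequentially"
    then show "tendsto_in_prob M (\<lambda>p \<omega>. FDP (support p (x p)) (S p (x p) \<omega>)) 0"
      and "tendsto_in_prob M (\<lambda>p \<omega>. NDP (support p (x p)) (S p (x p) \<omega>)) 0"
      using FDP[of \<mu> x] NDP[of \<mu> x] by auto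
  next
    fix \<mu> x
    assume "\<forall>p\<ge>1. \<mu> p > max (sqrt (4 / c\<^sub>1)) (2 * sqrt (2 / c\<^sub>k))" "\<forall>p\<ge>1. sparse_signal p \<beta> (\<mu> p) (x p)"
    then show "(\<lambda>p. measure (M p) {\<omega> \<in> space (M p). S p (x p) \<omega> = {}}) \<longlonglongrightarrow> 0"
      by (intro nonzero[of \<mu> x]) (auto intro: less_imp_le)
  qed (rule zero)
qed

end
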